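(* There are absolute constants $c,C>0$ such that for every $2<p<\infty$ and every integer $r\ge2$ there is a finite set $T$ contained in the unit sphere of $L^p[0,1]$ such that \[ |T|\le 2^{Cr^2},\qquad \gamma_2(T;L^p[0,1])\le Cr,\qquad \gamma_2(\operatorname{conv}T;L^p[0,1])\ge c\,r^{3/2-1/p}. \]
   Context: All Banach spaces are real; $[0,1]$ carries Lebesgue measure. An admissible sequence on a metric space $(K,d)$ is a refining sequence of partitions $(\mathcal A_n)_{n\ge0}$ of $K$ (each $\mathcal A_{n+1}$ refines $\mathcal A_n$) such that $|\mathcal A_0|=1$ and $|\mathcal A_n|\le2^{2^n}$ for $n\ge1$. For $x\in K$, $\mathcal A_n(x)$ is the element of $\mathcal A_n$ containing $x$. Define \[ \gamma_2(K,d)=\inf_{(\mathcal A_n)}\sup_{x\in K}\sum_{n\ge0}2^{n/2}\operatorname{diam}\bigl(\mathcal A_n(x)\bigr), \] the infimum being over all admissible sequences. For a subset $K$ of a Banach space $X$, $\gamma_2(K;X)$ is $\gamma_2(K,d)$ with $d$ the metric induced by the norm of $X$. $\operatorname{conv}T$ is the convex hull of $T$. *)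

theory Defs
  imports "HOL-Analysis.Analysis" "HOL-Library.Disjoint_Sets"
begin

definition admissible :: "'a set \<Rightarrow> (nat \<Rightarrow> 'a set set) \<Rightarrow> bool" where
  "admissible K \<A> \<longleftrightarrow>
     (\<forall>n. partition_on K (\<A> n)) \<and>
     (\<forall>n. refines K (\<A> (Suc n)) (\<A> n)) \<and>
     card (\<A> 0) = 1 \<and>
     (\<forall>n\<ge>1. finite (\<A> n) \<and> card (\<A> n) \<le> 2 ^ (2 ^ n))"

definition cell :: "'a set set \<Rightarrow> 'a \<Rightarrow> 'a set" where
  "cell P x = (THE A. A \<in> P \<and> x \<in> A)"

text \<open>Diameters, and hence the functional, take values in \<open>[0, \<infinity>]\<close>.\<close>

definition ediam :: "('a \<Rightarrow> 'a \<Rightarrow> real) \<Rightarrow> 'a set \<Rightarrow> ennreal" where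
  "ediam d A = (SUP x\<in>A. SUP y\<in>A. ennreal (d x y))"

definition gamma2 :: "'a set \<Rightarrow> ('a \<Rightarrow> 'a \<Rightarrow> real) \<Rightarrow> ennreal" where
  "gamma2 K d =
     (INF \<A>\<in>{\<A>. admissible K \<A>}.
        SUP x\<in>K. \<Sum>n. ennreal (2 powr (real n / 2)) * ediam d (cell (\<A> n) x))"

text \<open>
  The type \<open>L0\<close> is the space of classes of real measurable functions on \<open>[0,1]\<close> modulo equality
  almost everywhere. Functions are total on the reals, but both measurability and the null sets
  only concern their restrictions to \<open>[0,1]\<close>. Each \<open>L\<^sup>p\<close> is a subset of this one vector space, so
  that the exponent can be quantified over.
\<close>

abbreviation leb01 :: "real measure" where
  "leb01 \<equiv> lebesgue_on {0..1}"

definition ae_rel :: "(real \<Rightarrow> real) \<Rightarrow> (real \<Rightarrow> real) \<Rightarrow> bool" where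
  "ae_rel f g \<longleftrightarrow> f \<in> borel_measurable leb01 \<and> g \<in> borel_measurable leb01 \<and>
     (AE x in leb01. f x = g x)"

lemma ae_rel_part_equivp: "part_equivp ae_rel"
proof (rule part_equivpI)
  show "\<exists>f. ae_rel f f"
    by (rule exI[of _ "\<lambda>_. 0"]) (simp add: ae_rel_def)
  show "symp ae_rel"
    by (rule sympI) (auto simp: ae_rel_def elim: AE_mp)
  show "transp ae_rel"
  proof (rule transpI)
    fix f g h assume "ae_rel f g" "ae_rel g h"
    then show "ae_rel f h"
      unfolding ae_rel_def by (auto elim: eventually_elim2)
  qed
qed

quotient_type L0 = "real \<Rightarrow> real" / partial: ae_rel
  by (rule ae_rel_part_equivp)

instantiation L0 :: real_vector
begin

lift_definition zero_L0 :: L0 is "\<lambda>_. 0"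
  by (simp add: ae_rel_def)

lift_definition plus_L0 :: "L0 \<Rightarrow> L0 \<Rightarrow> L0" is "\<lambda>f g x. f x + g x"
  unfolding ae_rel_def by (auto elim: eventually_elim2)

lift_definition minus_L0 :: "L0 \<Rightarrow> L0 \<Rightarrow> L0" is "\<lambda>f g x. f x - g x"
  unfolding ae_rel_def by (auto elim: eventually_elim2)

lift_definition uminus_L0 :: "L0 \<Rightarrow> L0" is "\<lambda>f x. - f x"
  unfolding ae_rel_def by (auto elim: eventually_mono)

lift_definition scaleR_L0 :: "real \<Rightarrow> L0 \<Rightarrow> L0" is "\<lambda>a f x. a * f x"
  unfolding ae_rel_def by (auto elim: eventually_mono)

instance
  by standard (transfer, auto simp: ae_rel_def algebra_simps)+

end

lift_definition Lp_norm :: "real \<Rightarrow> L0 \<Rightarrow> real"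
  is "\<lambda>p f. (LINT x|leb01. \<bar>f x\<bar> powr p) powr (1 / p)"
proof -
  fix p f g assume "ae_rel f g"
  then have "(LINT x|leb01. \<bar>f x\<bar> powr p) = (LINT x|leb01. \<bar>g x\<bar> powr p)"
    unfolding ae_rel_def by (intro integral_cong_AE) (auto elim: eventually_mono)
  then show "(LINT x|leb01. \<bar>f x\<bar> powr p) powr (1 / p) = (LINT x|leb01. \<bar>g x\<bar> powr p) powr (1 / p)"
    by simp
qed

lift_definition in_Lp :: "real \<Rightarrow> L0 \<Rightarrow> bool"
  is "\<lambda>p f. integrable leb01 (\<lambda>x. \<bar>f x\<bar> powr p)"
proof -
  fix p f g assume "ae_rel f g"
  then show "integrable leb01 (\<lambda>x. \<bar>f x\<bar> powr p) = integrable leb01 (\<lambda>x. \<bar>g x\<bar> powr p)"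
    unfolding ae_rel_def by (intro integrable_cong_AE) (auto elim: eventually_mono)
qed

definition Lp_space :: "real \<Rightarrow> L0 set" where
  "Lp_space p = {f. in_Lp p f}"

text \<open>Outside \<open>Lp_space p\<close> the Bochner integral, and with it \<open>Lp_norm p\<close>, is zero by convention;
  the norm is meaningful on \<open>Lp_space p\<close> only.\<close>

definition Lp_sphere :: "real \<Rightarrow> L0 set" where
  "Lp_sphere p = {f \<in> Lp_space p. Lp_norm p f = 1}"

definition Lp_dist :: "real \<Rightarrow> L0 \<Rightarrow> L0 \<Rightarrow> real" where
  "Lp_dist p f g = Lp_norm p (f - g)"

definition gamma2_Lp :: "L0 set \<Rightarrow> real \<Rightarrow> ennreal" where
  "gamma2_Lp K p = gamma2 K (Lp_dist p)"

end

(*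
Divide [0,1] into r blocks of equal length and let T consist of all functions that on each block
equal one of N = 2^O(r) Walsh functions. All of them are +-1 valued and log |T| = O(r^2), which bounds
gamma_2(T) by taking T itself as the only cell until singletons become affordable.
On block j average 4^j Walsh functions, one from each of 4^j disjoint groups of size 4^b with b of
order r. There are 4^(b 4^j) such words, and by orthogonality words of Hamming distance at least
4^j / 2 give averages at L^2-distance at least 2^-j on the block, hence at L^p-distance at least
r^(-1/p) 2^-j. Choosing the words on the different blocks independently stays in conv T. A random
choice lies, for all levels n simultaneously, in a cell of proportion at least 2^(-2 2^n). At the
level n with 2^n of order r 4^j such a cell is larger than a Hamming ball on block j, so its
diameter is at least r^(-1/p) 2^-j. Each of the r blocks therefore contributes about r^(1/2 - 1/p).
*)

theory Submission
  imports Defs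
begin

section \<open>Bounds for the chaining functional\<close>

lemma cell_mem:
  assumes "admissible K \<A>" "x \<in> K"
  shows "cell (\<A> n) x \<in> \<A> n" "x \<in> cell (\<A> n) x"
proof -
  have P: "partition_on K (\<A> n)" using assms(1) by (simp add: admissible_def)
  have "\<exists>!A. A \<in> \<A> n \<and> x \<in> A"
    using partition_onD1[OF P] partition_onD2[OF P] assms(2) by (auto simp: disjoint_def)
  from theI'[OF this] show "cell (\<A> n) x \<in> \<A> n" "x \<in> cell (\<A> n) x"
    by (auto simp: cell_def)
qed

text \<open>Think of a uniformly drawn point of \<open>W\<close>. Level n has at most 2^(2^n) cells,
  so the cells of proportion below 2^(-2 * 2^n) together catch at most a share 2^(-2^n) of
  \<open>W\<close>. These shares sum to less than 1, hence some point avoids the small cells at all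
  levels of \<open>I\<close> at once. Its cell holds too many points to fit into the ball of radius
  \<open>e n\<close>, so it has at least that diameter.\<close>

lemma gamma2_ge_if_balls_small:
  fixes \<phi> :: "'w \<Rightarrow> 'a" and e :: "nat \<Rightarrow> real"
  assumes W: "finite W" "W \<noteq> {}" "\<phi> ` W \<subseteq> K" and I: "finite I"
    and ball: "\<And>n \<sigma>. n \<in> I \<Longrightarrow> \<sigma> \<in> W \<Longrightarrow>
      2 ^ (2 * 2 ^ n) * card {\<tau> \<in> W. d (\<phi> \<sigma>) (\<phi> \<tau>) < e n} < card W"
  shows "(\<Sum>n\<in>I. ennreal (2 powr (real n / 2) * e n)) \<le> gamma2 K d"
  unfolding gamma2_def
proof (rule INF_greatest, simp only: mem_Collect_eq)
  fix \<A> assume adm: "admissible K \<A>"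
  define F where "F n C = {\<tau> \<in> W. \<phi> \<tau> \<in> C}" for n :: nat and C
  define B where "B n = {\<sigma> \<in> W. 2 ^ (2 * 2 ^ n) * card (F n (cell (\<A> n) (\<phi> \<sigma>))) < card W}" for n
  have finF: "finite (F n C)" for n C using W by (simp add: F_def)
  have cards: "finite (\<A> n) \<and> card (\<A> n) \<le> 2 ^ (2 ^ n)" for n
  proof (cases "n = 0")
    case True
    \<comment> \<open>\<open>card\<close> is 0 on infinite sets, so cardinality 1 includes
      finiteness; \<open>admissible\<close> states finiteness only from level 1 on.\<close>
    have "card (\<A> 0) = 1" using adm by (simp add: admissible_def)
    then show ?thesis using True card_ge_0_finite[of "\<A> 0"] by simp
  next
    case False
    then show ?thesis using adm by (auto simp: admissible_def)
  qed
  have cardB: "2 ^ (2 ^ n) * card (B n) \<le> card W" for n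
  proof -
    define S where "S = {C \<in> \<A> n. 2 ^ (2 * 2 ^ n) * card (F n C) < card W}"
    have S: "finite S" "card S \<le> 2 ^ (2 ^ n)"
      using cards[of n] card_mono[of "\<A> n" S] by (auto simp: S_def)
    have "B n \<subseteq> (\<Union>C\<in>S. F n C)"
    proof
      fix \<sigma> assume s: "\<sigma> \<in> B n"
      then have "\<phi> \<sigma> \<in> K" using W by (auto simp: B_def)
      from cell_mem[OF adm this, of n] s show "\<sigma> \<in> (\<Union>C\<in>S. F n C)"
        by (auto simp: B_def S_def F_def intro!: bexI[of _ "cell (\<A> n) (\<phi> \<sigma>)"])
    qed
    then have "card (B n) \<le> card (\<Union>C\<in>S. F n C)"
      by (intro card_mono) (auto simp: S finF)
    also have "\<dots> \<le> (\<Sum>C\<in>S. card (F n C))" by (rule card_UN_le[OF S(1)])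
    finally have "2 ^ (2 * 2 ^ n) * card (B n) \<le> (\<Sum>C\<in>S. 2 ^ (2 * 2 ^ n) * card (F n C))"
      by (simp add: sum_distrib_left[symmetric])
    also have "\<dots> \<le> (\<Sum>C\<in>S. card W)" by (intro sum_mono) (auto simp: S_def)
    also have "\<dots> \<le> 2 ^ (2 ^ n) * card W" using S by simp
    finally have "2 ^ (2 ^ n) * (2 ^ (2 ^ n) * card (B n)) \<le> 2 ^ (2 ^ n) * card W"
      by (simp add: mult_2 power_add mult.assoc)
    then show ?thesis by simp
  qed
  have Bsub: "B n \<subseteq> W" for n by (auto simp: B_def)
  have "\<exists>\<sigma>\<in>W. \<forall>n\<in>I. \<sigma> \<notin> B n"
  proof (rule ccontr)
    assume "\<not> ?thesis"
    then have "W \<subseteq> (\<Union>n\<in>I. B n)" by auto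
    then have "card W \<le> card (\<Union>n\<in>I. B n)"
      using I finite_subset[OF Bsub W(1)] by (intro card_mono) auto
    also have "\<dots> \<le> (\<Sum>n\<in>I. card (B n))" by (rule card_UN_le[OF I])
    finally have 1: "real (card W) \<le> (\<Sum>n\<in>I. real (card (B n)))" by (metis of_nat_le_iff of_nat_sum)
    \<comment> \<open>Since 2^n >= n + 1, the share 2^(-2^n) is at most 2^(-(n+1)), and these sum to
      strictly less than 1 over a finite set of levels.\<close>
    have "real (card (B n)) \<le> real (card W) * (1/2) ^ Suc n" for n
    proof -
      have "2 ^ Suc n * card (B n) \<le> 2 ^ (2 ^ n) * card (B n)"
        by (intro mult_right_mono power_increasing) (simp_all add: Suc_leI)
      also note cardB
      finally have "real (2 ^ Suc n * card (B n)) \<le> real (card W)" by (simp only: of_nat_le_iff)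
      then show ?thesis by (simp add: field_simps)
    qed
    then have "(\<Sum>n\<in>I. real (card (B n))) \<le> real (card W) * (\<Sum>n\<in>I. (1/2) ^ Suc n)"
      by (subst sum_distrib_left) (rule sum_mono)
    also have "(\<Sum>n\<in>I. (1/2::real) ^ Suc n) < 1"
    proof -
      obtain m where m: "I \<subseteq> {..<m}" using I finite_nat_iff_bounded by blast
      have "(\<Sum>n\<in>I. (1/2::real) ^ Suc n) \<le> (\<Sum>n<m. (1/2) ^ Suc n)"
        using m by (intro sum_mono2) auto
      also have "\<dots> = 1 - (1/2) ^ m" by (induction m) (auto simp: field_simps)
      finally show ?thesis by (smt (verit) zero_less_power divide_pos_pos)
    qed
    finally show False using 1 W by (simp add: card_gt_0_iff)
  qed
  then obtain \<sigma> where \<sigma>: "\<sigma> \<in> W" and good: "\<And>n. n \<in> I \<Longrightarrow> \<sigma> \<notin> B n" by blast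
  have K: "\<phi> \<sigma> \<in> K" using \<sigma> W by auto
  have diam: "ennreal (e n) \<le> ediam d (cell (\<A> n) (\<phi> \<sigma>))" if n: "n \<in> I" for n
  proof -
    let ?C = "cell (\<A> n) (\<phi> \<sigma>)"
    \<comment> \<open>The ball is below the proportion 2^(-2 * 2^n) and the cell of a good point is
      not, so some point of the cell lies outside the ball.\<close>
    have "2 ^ (2 * 2 ^ n) * card {\<tau> \<in> W. d (\<phi> \<sigma>) (\<phi> \<tau>) < e n} < 2 ^ (2 * 2 ^ n) * card (F n ?C)"
      using good[OF n] \<sigma> by (intro order.strict_trans2[OF ball[OF n \<sigma>]]) (simp add: B_def)
    then have "\<not> F n ?C \<subseteq> {\<tau> \<in> W. d (\<phi> \<sigma>) (\<phi> \<tau>) < e n}"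
      using W card_mono[of "{\<tau> \<in> W. d (\<phi> \<sigma>) (\<phi> \<tau>) < e n}" "F n ?C"] by auto
    then obtain \<tau> where \<tau>: "\<phi> \<tau> \<in> ?C" "e n \<le> d (\<phi> \<sigma>) (\<phi> \<tau>)" by (force simp: F_def not_less)
    have "ennreal (e n) \<le> ennreal (d (\<phi> \<sigma>) (\<phi> \<tau>))" using \<tau> by (simp add: ennreal_leI)
    also have "\<dots> \<le> ediam d ?C"
      unfolding ediam_def using \<tau>(1) cell_mem(2)[OF adm K] by (meson SUP_upper2 SUP_upper)
    finally show ?thesis .
  qed
  have "(\<Sum>n\<in>I. ennreal (2 powr (real n / 2) * e n))
      \<le> (\<Sum>n\<in>I. ennreal (2 powr (real n / 2)) * ediam d (cell (\<A> n) (\<phi> \<sigma>)))"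
    by (intro sum_mono) (auto simp: ennreal_mult' intro!: mult_left_mono diam)
  also have "\<dots> \<le> (\<Sum>n. ennreal (2 powr (real n / 2)) * ediam d (cell (\<A> n) (\<phi> \<sigma>)))"
    by (intro sum_le_suminf) (auto simp: I)
  also have "\<dots> \<le> (SUP x\<in>K. \<Sum>n. ennreal (2 powr (real n / 2)) * ediam d (cell (\<A> n) x))"
    by (rule SUP_upper[OF K])
  finally show "(\<Sum>n\<in>I. ennreal (2 powr (real n / 2) * e n)) \<le> \<dots>" .
qed

section \<open>Upper bound for gamma_2 from cardinality and diameter\<close>

lemma gamma2_le_if_card_le:
  fixes d :: "'a \<Rightarrow> 'a \<Rightarrow> real"
  assumes T: "finite T" "T \<noteq> {}" and m: "card T \<le> 2 ^ (2 ^ m)" "m > 0"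
    and D: "\<And>x y. x \<in> T \<Longrightarrow> y \<in> T \<Longrightarrow> d x y \<le> D" and d0: "\<And>x. x \<in> T \<Longrightarrow> d x x = 0"
  shows "gamma2 T d \<le> ennreal ((\<Sum>n<m. 2 powr (real n / 2)) * D)"
proof -
  \<comment> \<open>Levels below \<open>m\<close> keep the trivial partition and cost at most
    \<open>D\<close> times their weight; from level \<open>m\<close> on singletons are affordable
    and cost 0. \<open>m > 0\<close> makes level 0 the single cell that admissibility
    demands.\<close>
  define \<A> where "\<A> n = (if n < m then {T} else (\<lambda>x. {x}) ` T)" for n
  have D0: "0 \<le> D" using T D d0 by force
  have part: "partition_on T (\<A> n)" for n
    using T by (auto simp: \<A>_def partition_on_def disjoint_def)
  have "card (\<A> n) \<le> 2 ^ (2 ^ n)" for n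
  proof (cases "n < m")
    case False
    then have "card (\<A> n) = card T" by (simp add: \<A>_def card_image inj_on_def)
    also note m(1)
    also have "(2::nat) ^ (2 ^ m) \<le> 2 ^ (2 ^ n)" using False by (intro power_increasing) auto
    finally show ?thesis .
  qed (simp add: \<A>_def)
  then have adm: "admissible T \<A>"
    unfolding admissible_def refines_def using part T m by (auto simp: \<A>_def)
  have "gamma2 T d \<le> (SUP x\<in>T. \<Sum>n. ennreal (2 powr (real n / 2)) * ediam d (cell (\<A> n) x))"
    unfolding gamma2_def by (rule INF_lower) (simp add: adm)
  also have "\<dots> \<le> ennreal ((\<Sum>n<m. 2 powr (real n / 2)) * D)"
  proof (rule SUP_least)
    fix x assume x: "x \<in> T"
    have 1: "ediam d (cell (\<A> n) x) \<le> ennreal D" for n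
      unfolding ediam_def
      using partition_onD1[OF part[of n]] cell_mem(1)[OF adm x, of n]
      by (intro SUP_least ennreal_leI D) auto
    have 2: "ediam d (cell (\<A> n) x) = 0" if "\<not> n < m" for n
    proof -
      have "cell (\<A> n) x = {x}" using cell_mem[OF adm x, of n] that by (auto simp: \<A>_def)
      then show ?thesis using d0[OF x] by (simp add: ediam_def)
    qed
    have "(\<Sum>n. ennreal (2 powr (real n / 2)) * ediam d (cell (\<A> n) x))
        = (\<Sum>n<m. ennreal (2 powr (real n / 2)) * ediam d (cell (\<A> n) x))"
      by (rule suminf_finite) (auto simp: 2)
    also have "\<dots> \<le> (\<Sum>n<m. ennreal (2 powr (real n / 2)) * ennreal D)"
      by (intro sum_mono mult_left_mono 1) auto
    also have "\<dots> = ennreal ((\<Sum>n<m. 2 powr (real n / 2)) * D)"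
      by (simp add: sum_distrib_right D0 flip: ennreal_mult)
    finally show "(\<Sum>n. ennreal (2 powr (real n / 2)) * ediam d (cell (\<A> n) x)) \<le> \<dots>" .
  qed
  finally show ?thesis .
qed

text \<open>Serves twice: to find the level at which singletons become affordable, and to choose
  \<open>e\<close> with 2^e comparable to r.\<close>

lemma power_two_between:
  fixes k :: nat
  assumes "k > 0"
  shows "\<exists>e. k \<le> 2 ^ e \<and> 2 ^ e < 2 * k"
  using assms
proof (induction k rule: nat_induct_non_zero)
  case 1
  show ?case by (rule exI[of _ 0]) simp
next
  case (Suc k)
  then obtain e where e: "k \<le> 2 ^ e" "2 ^ e < 2 * k" by blast
  show ?case
  proof (cases "k = 2 ^ e")
    case True
    then show ?thesis using Suc.hyps by (intro exI[of _ "Suc e"]) simp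
  next
    case False
    then show ?thesis using e by (intro exI[of _ e]) simp
  qed
qed

text \<open>Singletons are affordable at a level m with k <= 2^m < 2k, and the geometric sum of the
  weights below m is at most three times 2^(m/2).\<close>

lemma gamma2_le_sqrt_log_card:
  fixes d :: "'a \<Rightarrow> 'a \<Rightarrow> real"
  assumes T: "finite T" "T \<noteq> {}" and k: "card T \<le> 2 ^ k" "k \<ge> 2"
    and D: "\<And>x y. x \<in> T \<Longrightarrow> y \<in> T \<Longrightarrow> d x y \<le> D" and d0: "\<And>x. x \<in> T \<Longrightarrow> d x x = 0"
  shows "gamma2 T d \<le> ennreal (3 * sqrt (2 * real k) * D)"
proof -
  obtain m where m: "k \<le> 2 ^ m" "2 ^ m < 2 * k" using power_two_between[of k] k by auto
  have "m > 0" using m k by (cases m) auto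
  have "(2::nat) ^ k \<le> 2 ^ (2 ^ m)" using m by (intro power_increasing) auto
  with k(1) have "card T \<le> 2 ^ (2 ^ m)" by (rule order_trans)
  from gamma2_le_if_card_le[where d = d, OF T this \<open>m > 0\<close> D d0]
  have "gamma2 T d \<le> ennreal ((\<Sum>n<m. 2 powr (real n / 2)) * D)" .
  also have "\<dots> \<le> ennreal (3 * sqrt (2 * real k) * D)"
  proof (intro ennreal_leI mult_right_mono)
    \<comment> \<open>The induction step adds one term, 3 + 1 = 3 * (4/3), so the constant 3
      survives because the ratio sqrt 2 is at least 4/3.\<close>
    have "4 / 3 \<le> sqrt 2" by (rule real_le_rsqrt) (simp add: power2_eq_square)
    then have s: "4 / 3 \<le> (2::real) powr (1/2)" by (simp add: powr_half_sqrt)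
    have "(\<Sum>n<m. 2 powr (real n / 2)) \<le> 3 * 2 powr (real m / 2)"
    proof (induction m)
      case (Suc m)
      have "(\<Sum>n<Suc m. 2 powr (real n / 2)) \<le> 3 * (4 / 3 * 2 powr (real m / 2))" using Suc by simp
      also have "\<dots> \<le> 3 * (2 powr (1/2) * 2 powr (real m / 2))"
        by (intro mult_left_mono mult_right_mono s) auto
      also have "\<dots> = 3 * 2 powr (real (Suc m) / 2)" by (simp add: add_divide_distrib powr_add)
      finally show ?case .
    qed simp
    also have "2 powr (real m / 2) = sqrt (2 ^ m)"
      by (simp add: powr_half_sqrt[symmetric] powr_realpow[symmetric] powr_powr)
    also have "sqrt (2 ^ m) \<le> sqrt (2 * real k)"
    proof (rule real_sqrt_le_mono)
      have "real (2 ^ m) \<le> real (2 * k)" using m(2) by (simp only: of_nat_le_iff)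
      then show "2 ^ m \<le> 2 * real k" by simp
    qed
    finally show "(\<Sum>n<m. 2 powr (real n / 2)) \<le> 3 * sqrt (2 * real k)" by simp
    show "0 \<le> D" using T D d0 by force
  qed
  finally show ?thesis .
qed

section \<open>Step functions\<close>

lemma step_measurable:
  "(\<lambda>x::real. g (nat \<lfloor>real Q * x\<rfloor>) :: real) \<in> borel_measurable leb01"
proof -
  have "(\<lambda>x::real. nat \<lfloor>real Q * x\<rfloor>) \<in> measurable borel (count_space UNIV)" by measurable
  then have "(\<lambda>x::real. g (nat \<lfloor>real Q * x\<rfloor>)) \<in> borel_measurable borel" by measurable
  then show ?thesis by (simp add: borel_measurable_if_I measurable_completion measurable_restrict_space1)
qed

text \<open>With a fixed mesh 1/Q, vector operations and norms become finite computations with g.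
  Only the point x = 1 sees the value g Q, and it is a null set.\<close>

lift_definition step :: "nat \<Rightarrow> (nat \<Rightarrow> real) \<Rightarrow> L0" is "\<lambda>Q g x. g (nat \<lfloor>real Q * x\<rfloor>)"
  by (simp add: ae_rel_def step_measurable)

lemma step_diff: "step Q g - step Q h = step Q (\<lambda>q. g q - h q)"
proof transfer
  fix Q :: nat and g h :: "nat \<Rightarrow> real"
  show "ae_rel (\<lambda>x. g (nat \<lfloor>real Q * x\<rfloor>) - h (nat \<lfloor>real Q * x\<rfloor>))
      (\<lambda>x. g (nat \<lfloor>real Q * x\<rfloor>) - h (nat \<lfloor>real Q * x\<rfloor>))"
    using step_measurable[of "\<lambda>q. g q - h q" Q] by (simp only: ae_rel_def) simp
qed

lemma step_add: "step Q g + step Q h = step Q (\<lambda>q. g q + h q)"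
proof transfer
  fix Q :: nat and g h :: "nat \<Rightarrow> real"
  show "ae_rel (\<lambda>x. g (nat \<lfloor>real Q * x\<rfloor>) + h (nat \<lfloor>real Q * x\<rfloor>))
      (\<lambda>x. g (nat \<lfloor>real Q * x\<rfloor>) + h (nat \<lfloor>real Q * x\<rfloor>))"
    using step_measurable[of "\<lambda>q. g q + h q" Q] by (simp only: ae_rel_def) simp
qed

lemma step_scaleR: "c *\<^sub>R step Q g = step Q (\<lambda>q. c * g q)"
proof transfer
  fix c :: real and Q :: nat and g :: "nat \<Rightarrow> real"
  show "ae_rel (\<lambda>x. c * g (nat \<lfloor>real Q * x\<rfloor>)) (\<lambda>x. c * g (nat \<lfloor>real Q * x\<rfloor>))"
    using step_measurable[of "\<lambda>q. c * g q" Q] by (simp only: ae_rel_def) simp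
qed

lemma step_zero: "step Q (\<lambda>q. 0) = 0"
  by transfer (simp add: ae_rel_def)

lemma step_sum: "(\<Sum>i\<in>S. step Q (g i)) = step Q (\<lambda>q. \<Sum>i\<in>S. g i q)"
  by (induction S rule: infinite_finite_induct) (simp_all add: step_zero step_add)

lemma has_integral_step:
  fixes g :: "nat \<Rightarrow> real"
  assumes Q: "Q > 0"
  shows "has_bochner_integral leb01 (\<lambda>x. g (nat \<lfloor>real Q * x\<rfloor>)) ((\<Sum>q<Q. g q) / real Q)"
proof -
  define J where "J q = {real q / real Q ..< real (Suc q) / real Q}" for q
  have J01: "J q \<subseteq> {0..1}" if "q < Q" for q
  proof
    fix x assume x: "x \<in> J q"
    have "0 \<le> real q / real Q" "real (Suc q) / real Q \<le> 1" using that Q by auto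
    then show "x \<in> {0..1}" using x unfolding J_def atLeastLessThan_iff atLeastAtMost_iff by linarith
  qed
  have mem: "x \<in> J q \<longleftrightarrow> nat \<lfloor>real Q * x\<rfloor> = q" if "0 \<le> x" for x q
  proof -
    have "x \<in> J q \<longleftrightarrow> real q \<le> real Q * x \<and> real Q * x < real q + 1"
      using Q by (auto simp: J_def field_simps)
    also have "\<dots> \<longleftrightarrow> \<lfloor>real Q * x\<rfloor> = int q" by (simp add: floor_eq_iff)
    also have "\<dots> \<longleftrightarrow> nat \<lfloor>real Q * x\<rfloor> = q" using that by auto
    finally show ?thesis .
  qed
  have meas: "has_bochner_integral leb01 (indicator (J q) :: real \<Rightarrow> real) (1 / real Q)" if "q < Q" for q
  proof -
    have "has_bochner_integral leb01 (indicator (J q) :: real \<Rightarrow> real) (measure leb01 (J q))"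
    proof (rule has_bochner_integral_real_indicator)
      show "J q \<in> sets leb01" using J01[OF that] by (subst sets_restrict_space_iff) (auto simp: J_def)
      show "emeasure leb01 (J q) < \<infinity>"
        using J01[OF that] by (subst emeasure_restrict_space) (auto simp: J_def divide_right_mono)
    qed
    also have "measure leb01 (J q) = 1 / real Q"
      using J01[OF that] Q by (subst measure_restrict_space) (auto simp: J_def divide_right_mono field_simps)
    finally show ?thesis .
  qed
  have I: "has_bochner_integral leb01 (\<lambda>x. \<Sum>q<Q. g q * indicator (J q) x) (\<Sum>q<Q. g q * (1 / real Q))"
    by (intro has_bochner_integral_sum has_bochner_integral_mult_right meas) auto
  have AE: "AE x in leb01. (\<Sum>q<Q. g q * indicator (J q) x) = g (nat \<lfloor>real Q * x\<rfloor>)"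
  proof -
    \<comment> \<open>The half-open intervals \<open>J q\<close> with q < Q cover [0,1) and miss the
      point 1.\<close>
    have "AE x in lebesgue. x \<noteq> (1::real)"
      by (rule AE_I'[of "{1}"]) auto
    then have "AE x in leb01. x \<noteq> 1"
      by (subst AE_restrict_space_iff) auto
    then show ?thesis
    proof (rule AE_mp, intro AE_I2 impI)
      fix x :: real assume x: "x \<in> space leb01" "x \<noteq> 1"
      then have x0: "0 \<le> x" "x < 1" by auto
      then have "nat \<lfloor>real Q * x\<rfloor> < Q"
        using Q by (simp add: nat_less_iff floor_less_iff)
      moreover have "g q * indicator (J q) x = (if q = nat \<lfloor>real Q * x\<rfloor> then g q else 0)" for q
        using mem[OF x0(1), of q] by (auto simp: indicator_def)
      ultimately show "(\<Sum>q<Q. g q * indicator (J q) x) = g (nat \<lfloor>real Q * x\<rfloor>)"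
        by simp
    qed
  qed
  from has_bochner_integral_cong_AE[OF borel_measurable_has_bochner_integral[OF I] step_measurable AE,
      THEN iffD1, OF I]
  show ?thesis by (simp add: sum_divide_distrib)
qed

lemma step_in_Lp: "Q > 0 \<Longrightarrow> in_Lp p (step Q g)"
proof transfer
  fix Q :: nat and p :: real and g :: "nat \<Rightarrow> real" assume "Q > 0"
  from has_integral_step[OF this, of "\<lambda>q. \<bar>g q\<bar> powr p"]
  show "integrable leb01 (\<lambda>x. \<bar>g (nat \<lfloor>real Q * x\<rfloor>)\<bar> powr p)"
    by (simp add: has_bochner_integral_iff)
qed

lemma Lp_norm_step:
  assumes "Q > 0"
  shows "Lp_norm p (step Q g) = ((\<Sum>q<Q. \<bar>g q\<bar> powr p) / real Q) powr (1 / p)"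
  using assms
proof transfer
  fix Q :: nat and p :: real and g :: "nat \<Rightarrow> real" assume "Q > 0"
  from has_integral_step[OF this, of "\<lambda>q. \<bar>g q\<bar> powr p"]
  show "(LINT x|leb01. \<bar>g (nat \<lfloor>real Q * x\<rfloor>)\<bar> powr p) powr (1 / p)
      = ((\<Sum>q<Q. \<bar>g q\<bar> powr p) / real Q) powr (1 / p)"
    by (simp add: has_bochner_integral_iff)
qed

lemma Lp_norm_step_le:
  assumes "Q > 0" "p > 0" "D \<ge> 0" "\<And>q. \<bar>g q\<bar> \<le> D"
  shows "Lp_norm p (step Q g) \<le> D"
proof -
  have "(\<Sum>q<Q. \<bar>g q\<bar> powr p) \<le> (\<Sum>q<Q. D powr p)"
    using assms by (intro sum_mono powr_mono2) auto
  then have "(\<Sum>q<Q. \<bar>g q\<bar> powr p) / real Q \<le> D powr p"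
    using assms by (simp add: field_simps)
  then have "Lp_norm p (step Q g) \<le> (D powr p) powr (1 / p)"
    unfolding Lp_norm_step[OF assms(1)] using assms
    by (intro powr_mono2) (auto intro!: divide_nonneg_nonneg sum_nonneg)
  then show ?thesis using assms by (simp add: powr_powr)
qed

text \<open>Jensen's inequality for v^q: sum the tangent line at 1 over the values v = u i / A,
  whose total is at least card S.\<close>

lemma powr_mean:
  fixes u :: "'a \<Rightarrow> real"
  assumes "finite S" "q \<ge> 1" "\<And>i. i \<in> S \<Longrightarrow> u i \<ge> 0" "A \<ge> 0" "real (card S) * A \<le> (\<Sum>i\<in>S. u i)"
  shows "real (card S) * A powr q \<le> (\<Sum>i\<in>S. u i powr q)"
proof (cases "A = 0")
  case True
  then show ?thesis by (simp add: sum_nonneg)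
next
  case False
  then have A: "A > 0" using assms by simp
  have tangent: "1 + q * (v - 1) \<le> v powr q" if "v \<ge> 0" for v :: real
  proof (cases "v = 0")
    case False
    \<comment> \<open>Young's inequality for v^q and 1 with weights 1/q and 1 - 1/q reads v <= v^q /
      q + 1 - 1/q, which is the tangent inequality divided by q.\<close>
    then have "(v powr q) powr (1/q) * 1 powr (1 - 1/q) \<le> (1/q) * v powr q + (1 - 1/q) * 1"
      using assms that by (intro Youngs_inequality_0) (auto simp: field_simps)
    then have "q * v \<le> q * ((1/q) * v powr q + (1 - 1/q))"
      using assms that by (intro mult_left_mono) (auto simp: powr_powr)
    then show ?thesis using assms by (simp add: algebra_simps)
  qed (use assms in simp)
  have "real (card S) \<le> (\<Sum>i\<in>S. u i) / A"
    using assms A by (simp add: field_simps)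
  then have "real (card S) \<le> real (card S) + q * ((\<Sum>i\<in>S. u i) / A - real (card S))"
    using assms by simp
  also have "\<dots> = (\<Sum>i\<in>S. 1 + q * (u i / A - 1))"
    by (simp add: sum.distrib sum_subtractf sum_divide_distrib flip: sum_distrib_left)
  also have "\<dots> \<le> (\<Sum>i\<in>S. (u i / A) powr q)"
    using A assms by (intro sum_mono tangent) auto
  also have "\<dots> = (\<Sum>i\<in>S. u i powr q) / A powr q"
    using A assms by (simp add: powr_divide sum_divide_distrib)
  finally show ?thesis using A by (simp add: field_simps)
qed

text \<open>On one block the power mean inequality with exponent p/2 >= 1 raises the L^2 bound to an
  L^p bound. Dropping the other blocks costs r^(-1/p), as the block has measure 1/r.\<close>

lemma Lp_norm_step_block_ge:
  assumes p: "p \<ge> 2" and N: "N > 0" and j: "j < r" and s: "s \<ge> 0"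
    and L2: "real N * s\<^sup>2 \<le> (\<Sum>x<N. (g (j * N + x))\<^sup>2)"
  shows "real r powr (- 1 / p) * s \<le> Lp_norm p (step (r * N) g)"
proof -
  have r: "r > 0" using j by simp
  have pw: "(a\<^sup>2) powr (p / 2) = \<bar>a\<bar> powr p" for a :: real
    using powr_powr[of "\<bar>a\<bar>" 2 "p/2"] by (cases "a = 0") auto
  have "real N * s powr p = real (card {..<N}) * (s\<^sup>2) powr (p / 2)" using s by (simp add: pw)
  also have "\<dots> \<le> (\<Sum>x<N. ((g (j * N + x))\<^sup>2) powr (p / 2))"
    using p L2 by (intro powr_mean) auto
  also have "\<dots> = (\<Sum>x<N. \<bar>g (j * N + x)\<bar> powr p)" by (simp add: pw)
  also have "\<dots> = (\<Sum>q\<in>(\<lambda>x. j * N + x) ` {..<N}. \<bar>g q\<bar> powr p)"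
    by (simp add: sum.reindex)
  also have "\<dots> \<le> (\<Sum>q<r * N. \<bar>g q\<bar> powr p)"
  proof (rule sum_mono2)
    have "Suc j * N \<le> r * N" using j by (intro mult_right_mono) auto
    then show "(\<lambda>x. j * N + x) ` {..<N} \<subseteq> {..<r * N}" by auto
  qed auto
  finally have "s powr p / real r \<le> (\<Sum>q<r * N. \<bar>g q\<bar> powr p) / real (r * N)"
    using N r by (simp add: field_simps)
  then have "(s powr p / real r) powr (1 / p) \<le> Lp_norm p (step (r * N) g)"
    unfolding Lp_norm_step[OF mult_pos_pos[OF r N]] using p s r
    by (intro powr_mono2) auto
  moreover have "(s powr p / real r) powr (1 / p) = real r powr (- 1 / p) * s"
    using p s r by (simp add: powr_divide powr_powr powr_minus_divide)
  ultimately show ?thesis by simp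
qed

section \<open>Walsh functions and words\<close>

lemma sum_lessThan_add:
  fixes f :: "nat \<Rightarrow> 'a::comm_monoid_add"
  shows "(\<Sum>x<m + n. f x) = (\<Sum>x<m. f x) + (\<Sum>x<n. f (m + x))"
  by (induction n) (simp_all add: add.assoc)

text \<open>Sylvester-Hadamard matrix of order 2^L, whose rows are Walsh functions. The recursion
  strips the top binary digit of row and column; the sign flips when both digits are 1.\<close>

fun sylvester :: "nat \<Rightarrow> nat \<Rightarrow> nat \<Rightarrow> real" where
  "sylvester 0 n x = 1"
| "sylvester (Suc L) n x = sylvester L (n mod 2 ^ L) (x mod 2 ^ L) *
     (if n \<ge> 2 ^ L \<and> x \<ge> 2 ^ L then - 1 else 1)"

lemma abs_sylvester [simp]: "\<bar>sylvester L n x\<bar> = 1"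
  by (induction L arbitrary: n x) auto

text \<open>The second half of the sum repeats the first up to the sign \<open>s n * s n'\<close>.
  If the remainders differ both halves vanish; if they agree, the signs agree exactly when n =
  n'.\<close>

lemma sylvester_orthogonal:
  assumes "n < 2 ^ L" "n' < 2 ^ L"
  shows "(\<Sum>x<2 ^ L. sylvester L n x * sylvester L n' x) = (if n = n' then 2 ^ L else 0)"
  using assms
proof (induction L arbitrary: n n')
  case (Suc L)
  let ?N = "2 ^ L :: nat" and ?w = "sylvester L"
  define s where "s m = (if m \<ge> ?N then - 1 else 1 :: real)" for m
  define f where "f x = sylvester (Suc L) n x * sylvester (Suc L) n' x" for x
  let ?I = "\<Sum>x<?N. ?w (n mod ?N) x * ?w (n' mod ?N) x"
  have "(\<Sum>x<2 ^ Suc L. f x) = (\<Sum>x<?N. f x) + (\<Sum>x<?N. f (?N + x))"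
    using sum_lessThan_add[of f ?N ?N] by (simp add: mult_2)
  also have "\<dots> = ?I + s n * s n' * ?I"
    by (simp add: f_def s_def sum_distrib_left sum_negf)
  also have "\<dots> = (if n = n' then 2 ^ Suc L else 0)"
  proof (cases "n mod ?N = n' mod ?N")
    case True
    have "n = n mod ?N + (if n \<ge> ?N then ?N else 0)" "n' = n' mod ?N + (if n' \<ge> ?N then ?N else 0)"
      using Suc.prems by (auto simp: le_mod_geq)
    then have "n = n' \<longleftrightarrow> (n \<ge> ?N \<longleftrightarrow> n' \<ge> ?N)" using True by (smt (verit) add_left_cancel)
    then show ?thesis using True Suc.IH[of "n mod ?N" "n' mod ?N"] by (auto simp: s_def)
  qed (use Suc.IH[of "n mod ?N" "n' mod ?N"] in auto)
  finally show ?case by (simp add: f_def)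
qed auto

text \<open>Distinct positions use disjoint groups of rows, so the differences \<open>v i\<close>
  are pairwise orthogonal. Each has squared norm N + N where the letters differ and is zero where
  they agree.\<close>

lemma sum_words_square:
  fixes w :: "nat \<Rightarrow> nat \<Rightarrow> real"
  assumes orth: "\<And>n n'. n < N \<Longrightarrow> n' < N \<Longrightarrow>
      (\<Sum>x<N. w n x * w n' x) = (if n = n' then real N else 0)"
    and kM: "k * M \<le> N" and \<sigma>: "\<And>i. i < k \<Longrightarrow> \<sigma> i < M" and \<tau>: "\<And>i. i < k \<Longrightarrow> \<tau> i < M"
  shows "(\<Sum>x<N. (\<Sum>i<k. w (i * M + \<sigma> i) x - w (i * M + \<tau> i) x)\<^sup>2)
       = 2 * real N * real (card {i\<in>{..<k}. \<sigma> i \<noteq> \<tau> i})"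
proof -
  define v where "v i x = w (i * M + \<sigma> i) x - w (i * M + \<tau> i) x" for i x
  have lt: "i * M + a < N" if "i < k" "a < M" for i a
  proof -
    have "Suc i * M \<le> k * M" using that by (intro mult_right_mono) auto
    then show ?thesis using that kM by simp
  qed
  have eq: "i * M + a = i' * M + a' \<longleftrightarrow> i = i' \<and> a = a'" if "a < M" "a' < M" for i i' a a'
  proof
    assume e: "i * M + a = i' * M + a'"
    have "i = (i * M + a) div M" "i' = (i' * M + a') div M" using that by auto
    then show "i = i' \<and> a = a'" using e by auto
  qed auto
  have inner: "(\<Sum>x<N. v i x * v i' x)
      = (if i' = i then if \<sigma> i \<noteq> \<tau> i then 2 * real N else 0 else 0)"
    if "i < k" "i' < k" for i i'
  proof -
    have "(\<Sum>x<N. v i x * v i' x)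
      = (\<Sum>x<N. w (i * M + \<sigma> i) x * w (i' * M + \<sigma> i') x) - (\<Sum>x<N. w (i * M + \<sigma> i) x * w (i' * M + \<tau> i') x)
       - (\<Sum>x<N. w (i * M + \<tau> i) x * w (i' * M + \<sigma> i') x) + (\<Sum>x<N. w (i * M + \<tau> i) x * w (i' * M + \<tau> i') x)"
      unfolding v_def by (simp add: algebra_simps sum.distrib sum_subtractf)
    then show ?thesis using that by (simp add: orth lt eq \<sigma> \<tau>)
  qed
  have "(\<Sum>x<N. (\<Sum>i<k. v i x)\<^sup>2) = (\<Sum>x<N. \<Sum>i<k. \<Sum>i'<k. v i x * v i' x)"
    by (simp add: power2_eq_square sum_product)
  also have "\<dots> = (\<Sum>i<k. \<Sum>i'<k. \<Sum>x<N. v i x * v i' x)"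
    by (subst sum.swap, rule sum.cong[OF refl], rule sum.swap)
  also have "\<dots> = (\<Sum>i<k. \<Sum>i'<k. if i' = i then if \<sigma> i \<noteq> \<tau> i then 2 * real N else 0 else 0)"
    by (intro sum.cong refl inner) auto
  also have "\<dots> = (\<Sum>i<k. if \<sigma> i \<noteq> \<tau> i then 2 * real N else 0)" by simp
  also have "\<dots> = 2 * real N * real (card {i\<in>{..<k}. \<sigma> i \<noteq> \<tau> i})"
    by (subst sum.inter_filter[symmetric]) auto
  finally show ?thesis by (simp add: v_def)
qed

text \<open>A word in the ball is fixed by its set D of changed positions, at most 2^k choices, and
  its letters on D. These number 4^(b * card D) <= 2^(b * k), as 2 * card D < k.\<close>

lemma card_hamming_ball:
  fixes \<sigma> :: "nat \<Rightarrow> nat"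
  shows "card {\<tau> \<in> {..<k} \<rightarrow>\<^sub>E {..<4 ^ b :: nat}. 2 * card {i\<in>{..<k}. \<sigma> i \<noteq> \<tau> i} < k} \<le> 2 ^ (k + b * k)"
    (is "card ?B \<le> _")
proof -
  define \<D> where "\<D> = {D. D \<subseteq> {..<k} \<and> 2 * card D < k}"
  define f where "f D u = (\<lambda>i\<in>{..<k}. if i \<in> D then u i else \<sigma> i)" for D and u :: "nat \<Rightarrow> nat"
  have fin: "finite \<D>" by (rule finite_subset[of _ "Pow {..<k}"]) (auto simp: \<D>_def)
  have card\<D>: "card \<D> \<le> 2 ^ k"
    using card_mono[of "Pow {..<k}" \<D>] by (auto simp: \<D>_def card_Pow)
  have finD: "finite D" if "D \<in> \<D>" for D using that finite_subset by (auto simp: \<D>_def)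
  have "?B \<subseteq> (\<Union>D\<in>\<D>. f D ` (D \<rightarrow>\<^sub>E {..<4 ^ b}))"
  proof
    fix \<tau> assume \<tau>: "\<tau> \<in> ?B"
    let ?D = "{i\<in>{..<k}. \<sigma> i \<noteq> \<tau> i}"
    have "\<tau> = f ?D (restrict \<tau> ?D)"
      using \<tau> by (auto simp: f_def fun_eq_iff PiE_def extensional_def)
    moreover have "restrict \<tau> ?D \<in> ?D \<rightarrow>\<^sub>E {..<4 ^ b}" using \<tau> by auto
    moreover have "?D \<in> \<D>" using \<tau> by (auto simp: \<D>_def)
    ultimately show "\<tau> \<in> (\<Union>D\<in>\<D>. f D ` (D \<rightarrow>\<^sub>E {..<4 ^ b}))" by blast
  qed
  then have "card ?B \<le> card (\<Union>D\<in>\<D>. f D ` (D \<rightarrow>\<^sub>E {..<4 ^ b}))"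
    by (intro card_mono) (auto simp: fin finD intro!: finite_PiE)
  also have "\<dots> \<le> (\<Sum>D\<in>\<D>. card (f D ` (D \<rightarrow>\<^sub>E {..<4 ^ b})))" by (rule card_UN_le[OF fin])
  also have "\<dots> \<le> (\<Sum>D\<in>\<D>. 2 ^ (b * k))"
  proof (rule sum_mono)
    fix D assume D: "D \<in> \<D>"
    have "card (f D ` (D \<rightarrow>\<^sub>E {..<4 ^ b})) \<le> card (D \<rightarrow>\<^sub>E {..<4 ^ b :: nat})"
      by (intro card_image_le finite_PiE) (auto simp: finD D)
    also have "\<dots> = 4 ^ (b * card D)" by (simp add: card_PiE finD D power_mult)
    also have "\<dots> = 2 ^ (b * (2 * card D))"
      using power_mult[of "2::nat" 2 "b * card D"] by (simp add: algebra_simps)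
    also have "\<dots> \<le> 2 ^ (b * k)" using D by (intro power_increasing mult_left_mono) (auto simp: \<D>_def)
    finally show "card (f D ` (D \<rightarrow>\<^sub>E {..<4 ^ b})) \<le> 2 ^ (b * k)" .
  qed
  also have "\<dots> \<le> 2 ^ k * 2 ^ (b * k)" using card\<D> by simp
  finally show ?thesis by (simp add: power_add)
qed

text \<open>Independence of coordinates under counting measure: a condition on coordinate j alone
  has the proportion it has in \<open>P j\<close>. Cross-multiplied to stay in the naturals.\<close>

lemma card_PiE_coordinate:
  assumes "finite J" "j \<in> J" "B \<subseteq> P j"
  shows "card {\<tau> \<in> Pi\<^sub>E J P. \<tau> j \<in> B} * card (P j) = card B * card (Pi\<^sub>E J P)"
proof -
  have "{\<tau> \<in> Pi\<^sub>E J P. \<tau> j \<in> B} = Pi\<^sub>E J (P(j := B))"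
  proof (intro set_eqI iffI)
    fix \<tau> assume "\<tau> \<in> Pi\<^sub>E J (P(j := B))"
    then have "\<forall>i\<in>J. \<tau> i \<in> (P(j := B)) i" "\<tau> \<in> extensional J"
      by (auto simp only: PiE_iff)
    moreover have "(P(j := B)) i \<subseteq> P i" for i using assms by auto
    ultimately show "\<tau> \<in> {\<tau> \<in> Pi\<^sub>E J P. \<tau> j \<in> B}"
      using assms(2) by (force simp: PiE_iff)
  qed (auto simp: PiE_iff)
  then have "card {\<tau> \<in> Pi\<^sub>E J P. \<tau> j \<in> B} = (\<Prod>i\<in>J. card ((P(j := B)) i))"
    using assms by (simp add: card_PiE)
  also have "\<dots> = card B * (\<Prod>i\<in>J - {j}. card (P i))"
    using assms by (subst prod.remove[of _ j]) auto
  finally show ?thesis using assms by (simp add: card_PiE prod.remove[of J j])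
qed

text \<open>Averaging over 4^r indices reads a word of length 4^j exactly 4^(r-j) times.\<close>

lemma sum_mod_periods:
  fixes F :: "nat \<Rightarrow> real"
  shows "(\<Sum>i<a * k. F (i mod k)) = real a * (\<Sum>i<k. F i)"
proof (induction a)
  case (Suc a)
  have "(\<Sum>i<Suc a * k. F (i mod k)) = (\<Sum>i<a * k + k. F (i mod k))"
    by (rule arg_cong[where f = "\<lambda>m. \<Sum>i<m. F (i mod k)"]) simp
  also have "\<dots> = real (Suc a) * (\<Sum>i<k. F i)"
    by (simp add: sum_lessThan_add Suc.IH distrib_right)
  finally show ?case .
qed simp

section \<open>The point set\<close>

definition block_rows :: "nat \<Rightarrow> nat \<Rightarrow> (nat \<Rightarrow> nat) \<Rightarrow> L0" where
  "block_rows L r t = step (r * 2 ^ L) (\<lambda>q. sylvester L (t (q div 2 ^ L)) (q mod 2 ^ L))"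

lemma block_rows_in_Lp_sphere: "r > 0 \<Longrightarrow> block_rows L r t \<in> Lp_sphere p"
  by (simp add: Lp_sphere_def Lp_space_def block_rows_def step_in_Lp Lp_norm_step)

lemma Lp_dist_block_rows_le:
  assumes "r > 0" "p > 0"
  shows "Lp_dist p (block_rows L r t) (block_rows L r u) \<le> 2"
  unfolding Lp_dist_def block_rows_def step_diff
proof (rule Lp_norm_step_le)
  fix q
  show "\<bar>sylvester L (t (q div 2 ^ L)) (q mod 2 ^ L) - sylvester L (u (q div 2 ^ L)) (q mod 2 ^ L)\<bar> \<le> 2"
    using abs_sylvester[of L "t (q div 2 ^ L)" "q mod 2 ^ L"] abs_sylvester[of L "u (q div 2 ^ L)" "q mod 2 ^ L"]
    by linarith
qed (use assms in auto)

lemma Lp_dist_self: "Lp_dist p f f = 0"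
proof -
  have "Lp_dist p f f = Lp_norm p (step 1 (\<lambda>_. 0))" by (simp add: Lp_dist_def step_zero)
  then show ?thesis by (simp add: Lp_norm_step)
qed

section \<open>Averages of rows along words\<close>

abbreviation words :: "nat \<Rightarrow> nat \<Rightarrow> (nat \<Rightarrow> nat \<Rightarrow> nat) set" where
  "words b r \<equiv> \<Pi>\<^sub>E j\<in>{..<r}. {..<4 ^ j} \<rightarrow>\<^sub>E {..<4 ^ b}"

text \<open>Each position owns a group of 4^b rows, which makes rows at different positions distinct
  and hence orthogonal.\<close>

definition letter_row :: "nat \<Rightarrow> (nat \<Rightarrow> nat \<Rightarrow> nat) \<Rightarrow> nat \<Rightarrow> nat \<Rightarrow> nat" where
  "letter_row b \<sigma> j i = i * 4 ^ b + \<sigma> j i"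

text \<open>On block \<open>j\<close> this is the average of the \<open>4 ^ j\<close> rows spelled by the word \<open>\<sigma> j\<close>; averaging
  over the common multiple \<open>4 ^ r\<close> of the word lengths makes it visibly a convex combination.\<close>

definition word_point :: "nat \<Rightarrow> nat \<Rightarrow> (nat \<Rightarrow> nat \<Rightarrow> nat) \<Rightarrow> L0" where
  "word_point b r \<sigma> = (\<Sum>i<4 ^ r. (1 / 4 ^ r) *\<^sub>R
     block_rows (2 * (r + b)) r (\<lambda>j\<in>{..<r}. letter_row b \<sigma> j (i mod 4 ^ j)))"

text \<open>The point set contains every independent choice of rows on the blocks, so the rows read
  at index i on all blocks form one of its elements.\<close>

lemma word_point_in_hull:
  assumes \<sigma>: "\<sigma> \<in> words b r"
  shows "word_point b r \<sigma> \<in>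
    convex hull (block_rows (2 * (r + b)) r ` ({..<r} \<rightarrow>\<^sub>E {..<2 ^ (2 * (r + b))}))"
  unfolding word_point_def
proof (rule convex_sum)
  fix i :: nat
  \<comment> \<open>Here the order 2^L with L = 2 * (r + b) is accounted for: up to 4^r positions
    with 4^b rows each.\<close>
  have "letter_row b \<sigma> j (i mod 4 ^ j) < 2 ^ (2 * (r + b))" if j: "j < r" for j
  proof -
    have "\<sigma> j (i mod 4 ^ j) < 4 ^ b" using \<sigma> j by (auto simp: PiE_iff)
    then have "letter_row b \<sigma> j (i mod 4 ^ j) < Suc (i mod 4 ^ j) * 4 ^ b"
      by (simp add: letter_row_def)
    also have "\<dots> \<le> 4 ^ j * 4 ^ b" by (intro mult_right_mono) (auto simp: Suc_le_eq)
    also have "\<dots> \<le> 4 ^ r * 4 ^ b" using j by (intro mult_right_mono power_increasing) auto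
    also have "\<dots> = 2 ^ (2 * (r + b))" by (simp add: power_mult power_add)
    finally show ?thesis .
  qed
  then show "block_rows (2 * (r + b)) r (\<lambda>j\<in>{..<r}. letter_row b \<sigma> j (i mod 4 ^ j)) \<in>
    convex hull (block_rows (2 * (r + b)) r ` ({..<r} \<rightarrow>\<^sub>E {..<2 ^ (2 * (r + b))}))"
    by (intro hull_inc imageI restrict_PiE_iff[THEN iffD2]) simp
qed auto

text \<open>On block j the difference is 1/k times a sum of H orthogonal vectors of squared norm 2N,
  with k = 4^j. Since 2H >= k, its mean square is at least 1/k, the square of 2^(-j).\<close>

lemma Lp_dist_word_point_ge:
  assumes p: "p \<ge> 2" and \<sigma>: "\<sigma> \<in> words b r" and \<tau>: "\<tau> \<in> words b r" and j: "j < r"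
    and far: "4 ^ j \<le> 2 * card {i\<in>{..<4 ^ j}. \<sigma> j i \<noteq> \<tau> j i}"
  shows "real r powr (- 1 / p) * (1 / 2 ^ j) \<le> Lp_dist p (word_point b r \<sigma>) (word_point b r \<tau>)"
proof -
  define L where "L = 2 * (r + b)"
  define N :: nat where "N = 2 ^ L"
  define k :: nat where "k = 4 ^ j"
  define w where "w = sylvester L"
  define H where "H = card {i\<in>{..<k}. \<sigma> j i \<noteq> \<tau> j i}"
  define t where "t \<rho> i = (\<lambda>j\<in>{..<r}. letter_row b \<rho> j (i mod 4 ^ j))" for \<rho> i
  define g where "g = (\<lambda>q. (\<Sum>i<4 ^ r. 1 / 4 ^ r * w (t \<sigma> i (q div N)) (q mod N))
      - (\<Sum>i<4 ^ r. 1 / 4 ^ r * w (t \<tau> i (q div N)) (q mod N)))"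
  have N: "N > 0" by (simp add: N_def)
  have orth: "(\<Sum>x<N. w n x * w n' x) = (if n = n' then real N else 0)" if "n < N" "n' < N" for n n'
    using sylvester_orthogonal[of n L n'] that by (simp add: w_def N_def)
  have kM: "k * 4 ^ b \<le> N"
  proof -
    have "k * 4 ^ b \<le> 4 ^ r * 4 ^ b" unfolding k_def using j by (intro mult_right_mono power_increasing) auto
    also have "\<dots> = N" by (simp add: N_def L_def power_mult power_add)
    finally show ?thesis .
  qed
  have g: "g (j * N + x) = 1 / real k * (\<Sum>i<k. w (i * 4 ^ b + \<sigma> j i) x - w (i * 4 ^ b + \<tau> j i) x)"
    if x: "x < N" for x
  proof -
    have dm: "(j * N + x) div N = j" "(j * N + x) mod N = x" using x by auto
    define F where "F i = w (letter_row b \<sigma> j i) x - w (letter_row b \<tau> j i) x" for i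
    have pow4: "(4::nat) ^ r = 4 ^ (r - j) * k" using j by (simp add: k_def flip: power_add)
    \<comment> \<open>The factor 4^(r-j) from the periods cancels against 1 / 4^r and leaves the
      average over a single word.\<close>
    from arg_cong[OF this, of real] have pow4_real: "(4::real) ^ r = real (4 ^ (r - j)) * real k" by simp
    have pow: "(\<Sum>i<4 ^ r. F (i mod k)) = real (4 ^ (r - j)) * (\<Sum>i<k. F i)"
      by (simp only: pow4 sum_mod_periods)
    have "g (j * N + x) = 1 / 4 ^ r * (\<Sum>i<4 ^ r. F (i mod k))"
      using j x
      by (simp add: g_def dm t_def F_def k_def sum_distrib_left sum_subtractf right_diff_distrib
          diff_divide_distrib)
    also have "\<dots> = 1 / real k * (\<Sum>i<k. F i)"
      unfolding pow pow4_real by simp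
    finally show ?thesis by (simp add: F_def letter_row_def)
  qed
  have bnd: "\<sigma> j i < 4 ^ b" "\<tau> j i < 4 ^ b" if "i < k" for i
    using \<sigma> \<tau> j that by (auto simp: PiE_iff k_def)
  have "(\<Sum>x<N. (g (j * N + x))\<^sup>2)
      = (\<Sum>x<N. (1 / real k)\<^sup>2 * (\<Sum>i<k. w (i * 4 ^ b + \<sigma> j i) x - w (i * 4 ^ b + \<tau> j i) x)\<^sup>2)"
    by (intro sum.cong refl) (simp add: g power_mult_distrib power_divide)
  also have "\<dots> = (1 / real k)\<^sup>2 * (2 * real N * real H)"
    unfolding sum_distrib_left[symmetric] H_def
    by (subst sum_words_square[OF orth kM]) (auto simp: bnd)
  finally have sq: "(\<Sum>x<N. (g (j * N + x))\<^sup>2) = (1 / real k)\<^sup>2 * (2 * real N * real H)" .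
  have k0: "k > 0" by (simp add: k_def)
  have kH: "real k \<le> real (2 * H)" using far by (simp only: H_def k_def of_nat_le_iff)
  have "real k = (2 ^ j)\<^sup>2" by (simp add: k_def power2_eq_square flip: power_mult_distrib)
  then have "real N * (1 / 2 ^ j)\<^sup>2 = real N * real k * (1 / real k)\<^sup>2"
    using k0 by (simp add: power_divide power2_eq_square)
  also have "\<dots> \<le> real N * real (2 * H) * (1 / real k)\<^sup>2"
    by (intro mult_right_mono mult_left_mono kH) auto
  also have "\<dots> = (\<Sum>x<N. (g (j * N + x))\<^sup>2)" by (simp add: sq)
  finally have "real N * (1 / 2 ^ j)\<^sup>2 \<le> (\<Sum>x<N. (g (j * N + x))\<^sup>2)" .
  from Lp_norm_step_block_ge[OF p N j _ this]
  have "real r powr (- 1 / p) * (1 / 2 ^ j) \<le> Lp_norm p (step (r * N) g)" by simp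
  also have "step (r * N) g = word_point b r \<sigma> - word_point b r \<tau>"
    by (simp only: word_point_def block_rows_def step_scaleR step_sum step_diff g_def t_def w_def N_def L_def)
  finally show ?thesis by (simp add: Lp_dist_def)
qed

text \<open>The metric ball forces block j into a Hamming ball, whose proportion among the words of
  that block bounds that of the whole ball.\<close>

lemma card_word_point_ball:
  assumes p: "p \<ge> 2" and \<sigma>: "\<sigma> \<in> words b r" and j: "j < r" and b: "b = 1 + 4 * 2 ^ e"
  shows "2 ^ (2 * 2 ^ (e + 2 * j)) *
      card {\<tau> \<in> words b r. Lp_dist p (word_point b r \<sigma>) (word_point b r \<tau>) < real r powr (- 1 / p) * (1 / 2 ^ j)}
    < card (words b r)" (is "?A * card ?S < card ?W")
proof -
  define P where "P = (\<lambda>j. {..<4 ^ j :: nat} \<rightarrow>\<^sub>E {..<4 ^ b :: nat})"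
  define k :: nat where "k = 4 ^ j"
  define B where "B = {u \<in> P j. 2 * card {i\<in>{..<k}. \<sigma> j i \<noteq> u i} < k}"
  have k2: "k = 2 ^ (2 * j)" by (simp add: k_def power_mult)
  have W: "?W = Pi\<^sub>E {..<r} P" by (simp add: P_def)
  have finP: "finite (P i)" for i by (simp add: P_def finite_PiE)
  have finW: "finite ?W" unfolding W by (simp add: finite_PiE finP)
  have "?S \<subseteq> {\<tau> \<in> ?W. \<tau> j \<in> B}"
  proof
    fix \<tau> assume \<tau>: "\<tau> \<in> ?S"
    then have "\<not> 4 ^ j \<le> 2 * card {i\<in>{..<4 ^ j}. \<sigma> j i \<noteq> \<tau> j i}"
      using Lp_dist_word_point_ge[OF p \<sigma> _ j, of \<tau>] by auto
    moreover have "\<tau> j \<in> P j" using \<tau> j by (auto simp: P_def PiE_iff)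
    ultimately show "\<tau> \<in> {\<tau> \<in> ?W. \<tau> j \<in> B}" using \<tau> by (simp add: B_def k_def)
  qed
  then have 1: "card ?S \<le> card {\<tau> \<in> ?W. \<tau> j \<in> B}" using finW by (intro card_mono) auto
  have 2: "card B \<le> 2 ^ (k + b * k)"
    unfolding B_def P_def k_def by (rule card_hamming_ball)
  have "card (P j) = (4 ^ b) ^ k" by (simp add: P_def k_def card_PiE)
  also have "\<dots> = 2 ^ (b * k + b * k)"
    by (simp add: power_mult power_add flip: power_mult_distrib)
  \<comment> \<open>This dictates \<open>b\<close>: its summand 1 absorbs the 2^k choices of D, and
    4 * 2^e leaves the exponent 4 * 2^n at level n = e + 2j, strictly above the required 2 *
    2^n.\<close>
  also have "b * k + b * k = (k + b * k) + 4 * 2 ^ (e + 2 * j)"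
    by (simp add: b k2 power_add algebra_simps)
  finally have 3: "card (P j) = 2 ^ (k + b * k) * 2 ^ (4 * 2 ^ (e + 2 * j))" by (simp add: power_add)
  have "2 ^ (k + b * k) * (2 ^ (4 * 2 ^ (e + 2 * j)) * card ?S) \<le> card {\<tau> \<in> ?W. \<tau> j \<in> B} * card (P j)"
    using 1 by (simp add: 3 mult_ac)
  also have "\<dots> = card B * card ?W"
    unfolding W by (rule card_PiE_coordinate) (use j in \<open>auto simp: B_def\<close>)
  also have "\<dots> \<le> 2 ^ (k + b * k) * card ?W" using 2 by simp
  finally have 4: "2 ^ (4 * 2 ^ (e + 2 * j)) * card ?S \<le> card ?W" by simp
  show ?thesis
  proof (cases "card ?S = 0")
    case True
    have "card ?W > 0" using \<sigma> finW by (subst card_gt_0_iff) auto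
    then show ?thesis unfolding True by simp
  next
    case False
    have "?A < 2 ^ (4 * 2 ^ (e + 2 * j))" by (intro power_strict_increasing) auto
    then have "?A * card ?S < 2 ^ (4 * 2 ^ (e + 2 * j)) * card ?S"
      using False by (intro mult_strict_right_mono) auto
    also note 4
    finally show ?thesis .
  qed
qed

text \<open>Block j is tested at level e + 2j, whose weight 2^(e/2) * 2^j cancels the factor 2^(-j)
  of the radius. Each of the r blocks thus contributes 2^(e/2) * r^(-1/p), at least r^(1/2 -
  1/p).\<close>

lemma gamma2_word_points:
  assumes p: "p \<ge> 2" and b: "b = 1 + 4 * 2 ^ e" and e: "r \<le> 2 ^ e" and r: "r > 0"
    and K: "word_point b r ` words b r \<subseteq> K"
  shows "ennreal (real r powr (3 / 2 - 1 / p)) \<le> gamma2_Lp K p"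
proof -
  define f where "f j = e + 2 * j" for j :: nat
  \<comment> \<open>The radius must be a function of the level, so j is recovered as (n - e) div
    2.\<close>
  define \<epsilon> where "\<epsilon> n = real r powr (- 1 / p) * (1 / 2 ^ ((n - e) div 2))" for n
  have fe: "\<epsilon> (f j) = real r powr (- 1 / p) * (1 / 2 ^ j)" for j by (simp add: \<epsilon>_def f_def)
  have "real r powr (3 / 2 - 1 / p) = real r * (real r powr (1 / 2) * real r powr (- 1 / p))"
  proof -
    have "3 / 2 - 1 / p = 1 + (1 / 2 + (- 1 / p))" by simp
    then show ?thesis using r by (simp only: powr_add) simp
  qed
  also have "\<dots> \<le> real r * ((2 ^ e) powr (1 / 2) * real r powr (- 1 / p))"
    using of_nat_mono[OF e, where 'a = real] by (intro mult_left_mono mult_right_mono powr_mono2) auto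
  also have "\<dots> = (\<Sum>j<r. 2 powr (real (f j) / 2) * \<epsilon> (f j))"
  proof -
    have "(2 ^ e) powr (1 / 2) = (2::real) powr (real e / 2)"
      by (subst powr_realpow[symmetric]) (simp_all add: powr_powr)
    moreover have "2 powr (real (f j) / 2) = 2 powr (real e / 2) * 2 ^ j" for j
      by (simp add: f_def add_divide_distrib powr_add powr_realpow)
    ultimately show ?thesis by (simp add: fe)
  qed
  also have "ennreal (\<Sum>j<r. 2 powr (real (f j) / 2) * \<epsilon> (f j))
      = (\<Sum>n\<in>f ` {..<r}. ennreal (2 powr (real n / 2) * \<epsilon> n))"
    by (subst sum.reindex) (auto simp: inj_on_def f_def \<epsilon>_def)
  also have "\<dots> \<le> gamma2 K (Lp_dist p)"
  proof (rule gamma2_ge_if_balls_small[OF _ _ K])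
    show "finite (words b r)" by (simp add: finite_PiE)
    show "words b r \<noteq> {}" by (auto simp: PiE_eq_empty_iff lessThan_empty_iff)
    fix n \<sigma> assume "n \<in> f ` {..<r}" and \<sigma>: "\<sigma> \<in> words b r"
    then obtain j where j: "j < r" "n = f j" by auto
    show "2 ^ (2 * 2 ^ n) * card {\<tau> \<in> words b r. Lp_dist p (word_point b r \<sigma>) (word_point b r \<tau>) < \<epsilon> n}
        < card (words b r)"
      using card_word_point_ball[OF p \<sigma> j(1) b] unfolding j(2) fe by (simp only: f_def)
  qed simp
  finally show ?thesis by (simp add: gamma2_Lp_def ennreal_leI)
qed

theorem mainTheorem2:
  shows "\<exists>c C :: real. c > 0 \<and> C > 0 \<and>
    (\<forall>(p::real) (r::nat). p > 2 \<longrightarrow> r \<ge> 2 \<longrightarrow>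
      (\<exists>T. finite T \<and> T \<subseteq> Lp_sphere p \<and>
         real (card T) \<le> 2 powr (C * (real r)\<^sup>2) \<and>
         gamma2_Lp T p \<le> ennreal (C * real r) \<and>
         gamma2_Lp (convex hull T) p \<ge> ennreal (c * real r powr (3 / 2 - 1 / p))))"
proof (rule exI[of _ 1], rule exI[of _ 42], intro conjI allI impI)
  fix p :: real and r :: nat
  assume p: "p > 2" and r: "r \<ge> 2"
  obtain e where e: "r \<le> 2 ^ e" "2 ^ e < 2 * r" using power_two_between[of r] r by auto
  define b :: nat where "b = 1 + 4 * 2 ^ e"
  define L where "L = 2 * (r + b)"
  define T where "T = block_rows L r ` ({..<r} \<rightarrow>\<^sub>E {..<2 ^ L})"
  have fin: "finite T" by (simp add: T_def finite_PiE)
  have ne: "T \<noteq> {}" by (auto simp: T_def PiE_eq_empty_iff lessThan_empty_iff)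
  \<comment> \<open>From 2^e < 2r: L = 2 * (r + 1 + 4 * 2^e) <= 18r + 2 <= 20r.\<close>
  have "L \<le> 20 * r" using e r by (simp add: L_def b_def)
  then have Lr: "L * r \<le> 20 * r\<^sup>2" by (simp add: power2_eq_square)
  have "card T \<le> card ({..<r} \<rightarrow>\<^sub>E {..<2 ^ L :: nat})"
    unfolding T_def by (intro card_image_le finite_PiE) auto
  also have "\<dots> = 2 ^ (L * r)" by (simp add: card_PiE power_mult)
  also have "\<dots> \<le> 2 ^ (20 * r\<^sup>2)" using Lr by (intro power_increasing) auto
  finally have card: "card T \<le> 2 ^ (20 * r\<^sup>2)" .
  have "2 * 1 \<le> 20 * r\<^sup>2" using r by (intro mult_mono) auto
  then have k2: "2 \<le> 20 * r\<^sup>2" by simp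
  have diam: "Lp_dist p x y \<le> 2" if xy: "x \<in> T" "y \<in> T" for x y
  proof -
    obtain t u where "x = block_rows L r t" "y = block_rows L r u"
      using xy unfolding T_def by blast
    then show ?thesis using Lp_dist_block_rows_le[of r p L t u] p r by simp
  qed
  have "gamma2_Lp T p \<le> ennreal (3 * sqrt (2 * real (20 * r\<^sup>2)) * 2)"
    unfolding gamma2_Lp_def by (rule gamma2_le_sqrt_log_card[OF fin ne card k2 diam Lp_dist_self])
  also have "\<dots> \<le> ennreal (42 * real r)"
  proof (rule ennreal_leI)
    \<comment> \<open>As 40 <= 49, the bound is 3 * 7r * 2 = 42r, which fixes the constant 42; it
      also exceeds the 20 of the cardinality bound.\<close>
    have "sqrt (2 * real (20 * r\<^sup>2)) \<le> 7 * real r"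
      by (rule real_le_lsqrt) (auto simp: power_mult_distrib)
    then show "3 * sqrt (2 * real (20 * r\<^sup>2)) * 2 \<le> 42 * real r" by simp
  qed
  finally have upper: "gamma2_Lp T p \<le> ennreal (42 * real r)" .
  have hull: "word_point b r ` words b r \<subseteq> convex hull T"
    unfolding T_def L_def by (intro image_subsetI word_point_in_hull)
  have lower: "ennreal (1 * real r powr (3 / 2 - 1 / p)) \<le> gamma2_Lp (convex hull T) p"
    unfolding mult_1 by (rule gamma2_word_points[OF _ b_def e(1) _ hull]) (use p r in auto)
  have "real (card T) \<le> real (2 ^ (20 * r\<^sup>2))" using card by (simp only: of_nat_le_iff)
  also have "\<dots> = 2 powr (real (20 * r\<^sup>2))" by (subst powr_realpow) simp_all
  also have "\<dots> \<le> 2 powr (42 * (real r)\<^sup>2)" by (intro powr_mono) auto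
  finally have "real (card T) \<le> 2 powr (42 * (real r)\<^sup>2)" .
  moreover have "T \<subseteq> Lp_sphere p"
    unfolding T_def by (intro image_subsetI block_rows_in_Lp_sphere) (use r in simp)
  ultimately show "\<exists>T. finite T \<and> T \<subseteq> Lp_sphere p \<and>
      real (card T) \<le> 2 powr (42 * (real r)\<^sup>2) \<and> gamma2_Lp T p \<le> ennreal (42 * real r) \<and>
      gamma2_Lp (convex hull T) p \<ge> ennreal (1 * real r powr (3 / 2 - 1 / p))"
    using fin upper lower by blast
qed simp_all

end
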